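(* Let $E$ be a sequential effect space and let $V$ be its associated order unit space. Then the positive cone of $V$ is homogeneous.
   Context: Effect algebra: a set $E$ with elements $0,1$ and a partially defined operation $+$ that is commutative and associative (where defined: if $x+y$ is defined so is $y+x$ and they are equal; if $y+z$ and $x+(y+z)$ are defined then so are $x+y$ and $(x+y)+z$, and $x+(y+z)=(x+y)+z$), with $x+0=x$ always defined, such that $x+1$ defined implies $x=0$, and such that each $x$ has a unique $x^\perp$ with $x+x^\perp=1$. It is partially ordered by $x\leq y\iff\exists z: x+z=y$. Sequential effect algebra (SEA): an effect algebra with a total binary operation $\circ$ (the sequential product) such that, writing $a\mid b$ for $a\circ b=b\circ a$: (1) $a\circ(b+c)=a\circ b+a\circ c$ whenever $b+c$ is defined; (2) $1\circ a=a$; (3) $a\circ b=0\Rightarrow b\circ a=0$; (4) if $a\mid b$ then $a\mid b^\perp$ and $a\circ(b\circ c)=(a\circ b)\circ c$ for all $c$; (5) if $c\mid a$ and $c\mid b$ then $c\mid(a\circ b)$ and, if $a+b$ is defined, $c\mid(a+b)$. $\sigma$-SEA: a SEA in which every descending sequence $a_1\geq a_2\geq\cdots$ has an infimum $\bigwedge a_i$, with $b\circ\bigwedge a_i=\bigwedge(b\circ a_i)$, and $b\mid a_i$ for all $i$ implies $b\mid\bigwedge a_i$. Convex effect algebra: an effect algebra with an action $[0,1]\times E\to E$ such that for $r,s\in[0,1]$: if $r+s\leq 1$ then $ra+sa$ is defined and equals $(r+s)a$; $(rs)a=r(sa)$; $0a=0$, $1a=a$; if $a+b$ is defined then $ra+rb$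 is defined and equals $r(a+b)$. A sequential effect space (SES) is a convex $\sigma$-SEA. An order unit space $(V,C,1)$ is a real vector space with a proper cone $C$ ($C\cap(-C)=\{0\}$, $\mathrm{span}(C)=V$), ordered by $v\leq w\iff w-v\in C$, with an element $1$ such that every $v$ satisfies $-n1\leq v\leq n1$ for some $n\in\mathbb N$, and $v\leq\frac1n1$ for all $n\geq 1$ implies $v\leq 0$; its norm is $\|v\|=\inf\{r>0:-r1\leq v\leq r1\}$. Every SES $E$ is isomorphic, as a convex effect algebra, to the unit interval $[0,1]_V=\{v:0\leq v\leq 1\}$ of an order unit space $V$ (with $+$ defined when the sum is $\leq 1$); this $V$ is its associated order unit space. The cone $C$ of $V$ is homogeneous when for every two elements $a,b$ in the interior of $C$ (with respect to the norm of $V$) there is an order isomorphism $\Phi:V\to V$ (a linear bijection with $v\in C\iff\Phi(v)\in C$) such that $\Phi(a)=b$. *)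

theory Defs
  imports "HOL-Analysis.Analysis"
begin

section \<open>Effect algebras\<close>

text \<open>
  The partial addition is represented by a definedness predicate \<open>ea_summable\<close> together with a
  total function \<open>ea_add\<close>, whose value matters only on pairs of elements of the carrier that
  satisfy \<open>ea_summable\<close>.
\<close>

record 'e ea =
  ea_carrier :: "'e set"
  ea_zero :: 'e
  ea_one :: 'e
  ea_summable :: "'e \<Rightarrow> 'e \<Rightarrow> bool"
  ea_add :: "'e \<Rightarrow> 'e \<Rightarrow> 'e"

definition ea_le :: "'e ea \<Rightarrow> 'e \<Rightarrow> 'e \<Rightarrow> bool" where
  "ea_le E x y \<longleftrightarrow> (\<exists>z \<in> ea_carrier E. ea_summable E x z \<and> ea_add E x z = y)"

definition ea_compl :: "'e ea \<Rightarrow> 'e \<Rightarrow> 'e" where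
  "ea_compl E x = (THE y. y \<in> ea_carrier E \<and> ea_summable E x y \<and> ea_add E x y = ea_one E)"

definition ea_is_inf :: "'e ea \<Rightarrow> 'e set \<Rightarrow> 'e \<Rightarrow> bool" where
  "ea_is_inf E S x \<longleftrightarrow>
     x \<in> ea_carrier E \<and> (\<forall>s \<in> S. ea_le E x s) \<and>
     (\<forall>y \<in> ea_carrier E. (\<forall>s \<in> S. ea_le E y s) \<longrightarrow> ea_le E y x)"

definition ea_descending :: "'e ea \<Rightarrow> (nat \<Rightarrow> 'e) \<Rightarrow> bool" where
  "ea_descending E a \<longleftrightarrow> (\<forall>i. a i \<in> ea_carrier E) \<and> (\<forall>i. ea_le E (a (Suc i)) (a i))"

locale effect_algebra =
  fixes E :: "'e ea"
  assumes zero_closed: "ea_zero E \<in> ea_carrier E"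
    and one_closed: "ea_one E \<in> ea_carrier E"
    and add_closed: "\<lbrakk>x \<in> ea_carrier E; y \<in> ea_carrier E; ea_summable E x y\<rbrakk>
          \<Longrightarrow> ea_add E x y \<in> ea_carrier E"
    and add_comm: "\<lbrakk>x \<in> ea_carrier E; y \<in> ea_carrier E; ea_summable E x y\<rbrakk>
          \<Longrightarrow> ea_summable E y x \<and> ea_add E y x = ea_add E x y"
    and add_assoc: "\<lbrakk>x \<in> ea_carrier E; y \<in> ea_carrier E; z \<in> ea_carrier E;
            ea_summable E y z; ea_summable E x (ea_add E y z)\<rbrakk>
          \<Longrightarrow> ea_summable E x y \<and> ea_summable E (ea_add E x y) z \<and>
              ea_add E x (ea_add E y z) = ea_add E (ea_add E x y) z"
    and add_zero: "x \<in> ea_carrier E \<Longrightarrow> ea_summable E x (ea_zero E) \<and> ea_add E x (ea_zero E) = x"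
    and def_one: "\<lbrakk>x \<in> ea_carrier E; ea_summable E x (ea_one E)\<rbrakk> \<Longrightarrow> x = ea_zero E"
    and compl_unique: "x \<in> ea_carrier E \<Longrightarrow>
          \<exists>!y. y \<in> ea_carrier E \<and> ea_summable E x y \<and> ea_add E x y = ea_one E"

section \<open>Sequential effect algebras and sequential effect spaces\<close>

definition ea_commutes :: "('e \<Rightarrow> 'e \<Rightarrow> 'e) \<Rightarrow> 'e \<Rightarrow> 'e \<Rightarrow> bool" where
  "ea_commutes sprod a b \<longleftrightarrow> sprod a b = sprod b a"

locale sequential_effect_algebra = effect_algebra E for E :: "'e ea" +
  fixes sprod :: "'e \<Rightarrow> 'e \<Rightarrow> 'e"
  assumes sprod_closed: "\<lbrakk>a \<in> ea_carrier E; b \<in> ea_carrier E\<rbrakk> \<Longrightarrow> sprod a b \<in> ea_carrier E"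
    and sprod_add: "\<lbrakk>a \<in> ea_carrier E; b \<in> ea_carrier E; c \<in> ea_carrier E; ea_summable E b c\<rbrakk>
          \<Longrightarrow> ea_summable E (sprod a b) (sprod a c) \<and>
              sprod a (ea_add E b c) = ea_add E (sprod a b) (sprod a c)"
    and one_sprod: "a \<in> ea_carrier E \<Longrightarrow> sprod (ea_one E) a = a"
    and sprod_zero_sym: "\<lbrakk>a \<in> ea_carrier E; b \<in> ea_carrier E; sprod a b = ea_zero E\<rbrakk>
          \<Longrightarrow> sprod b a = ea_zero E"
    and commutes_compl: "\<lbrakk>a \<in> ea_carrier E; b \<in> ea_carrier E; ea_commutes sprod a b\<rbrakk>
          \<Longrightarrow> ea_commutes sprod a (ea_compl E b)"
    and commutes_assoc: "\<lbrakk>a \<in> ea_carrier E; b \<in> ea_carrier E; c \<in> ea_carrier E;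
            ea_commutes sprod a b\<rbrakk>
          \<Longrightarrow> sprod a (sprod b c) = sprod (sprod a b) c"
    and commutes_sprod: "\<lbrakk>a \<in> ea_carrier E; b \<in> ea_carrier E; c \<in> ea_carrier E;
            ea_commutes sprod c a; ea_commutes sprod c b\<rbrakk>
          \<Longrightarrow> ea_commutes sprod c (sprod a b)"
    and commutes_add: "\<lbrakk>a \<in> ea_carrier E; b \<in> ea_carrier E; c \<in> ea_carrier E;
            ea_commutes sprod c a; ea_commutes sprod c b; ea_summable E a b\<rbrakk>
          \<Longrightarrow> ea_commutes sprod c (ea_add E a b)"

locale sigma_sequential_effect_algebra = sequential_effect_algebra E sprod
  for E :: "'e ea" and sprod :: "'e \<Rightarrow> 'e \<Rightarrow> 'e" +
  assumes inf_exists: "ea_descending E a \<Longrightarrow> \<exists>x. ea_is_inf E (range a) x"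
    and sprod_inf: "\<lbrakk>ea_descending E a; ea_is_inf E (range a) x; b \<in> ea_carrier E\<rbrakk>
          \<Longrightarrow> ea_is_inf E (range (\<lambda>i. sprod b (a i))) (sprod b x)"
    and commutes_inf: "\<lbrakk>ea_descending E a; ea_is_inf E (range a) x; b \<in> ea_carrier E;
            \<And>i. ea_commutes sprod b (a i)\<rbrakk>
          \<Longrightarrow> ea_commutes sprod b x"

text \<open>The scalar action is only constrained for scalars in the real unit interval.\<close>

locale convex_effect_algebra = effect_algebra E for E :: "'e ea" +
  fixes smul :: "real \<Rightarrow> 'e \<Rightarrow> 'e"
  assumes smul_closed: "\<lbrakk>r \<in> {0..1}; a \<in> ea_carrier E\<rbrakk> \<Longrightarrow> smul r a \<in> ea_carrier E"
    and smul_add_left: "\<lbrakk>r \<in> {0..1}; s \<in> {0..1}; r + s \<le> 1; a \<in> ea_carrier E\<rbrakk>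
          \<Longrightarrow> ea_summable E (smul r a) (smul s a) \<and>
              ea_add E (smul r a) (smul s a) = smul (r + s) a"
    and smul_smul: "\<lbrakk>r \<in> {0..1}; s \<in> {0..1}; a \<in> ea_carrier E\<rbrakk>
          \<Longrightarrow> smul (r * s) a = smul r (smul s a)"
    and zero_smul: "a \<in> ea_carrier E \<Longrightarrow> smul 0 a = ea_zero E"
    and one_smul: "a \<in> ea_carrier E \<Longrightarrow> smul 1 a = a"
    and smul_add_right: "\<lbrakk>r \<in> {0..1}; a \<in> ea_carrier E; b \<in> ea_carrier E; ea_summable E a b\<rbrakk>
          \<Longrightarrow> ea_summable E (smul r a) (smul r b) \<and>
              ea_add E (smul r a) (smul r b) = smul r (ea_add E a b)"

locale sequential_effect_space =
  sigma_sequential_effect_algebra E sprod + convex_effect_algebra E smul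
  for E :: "'e ea" and sprod :: "'e \<Rightarrow> 'e \<Rightarrow> 'e" and smul :: "real \<Rightarrow> 'e \<Rightarrow> 'e"

definition convex_ea_iso ::
  "('a \<Rightarrow> 'b) \<Rightarrow> 'a ea \<Rightarrow> (real \<Rightarrow> 'a \<Rightarrow> 'a) \<Rightarrow> 'b ea \<Rightarrow> (real \<Rightarrow> 'b \<Rightarrow> 'b) \<Rightarrow> bool" where
  "convex_ea_iso f E smul F smul' \<longleftrightarrow>
     bij_betw f (ea_carrier E) (ea_carrier F) \<and>
     f (ea_zero E) = ea_zero F \<and> f (ea_one E) = ea_one F \<and>
     (\<forall>x \<in> ea_carrier E. \<forall>y \<in> ea_carrier E. ea_summable E x y \<longleftrightarrow> ea_summable F (f x) (f y)) \<and>
     (\<forall>x \<in> ea_carrier E. \<forall>y \<in> ea_carrier E. ea_summable E x y \<longrightarrow>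
        f (ea_add E x y) = ea_add F (f x) (f y)) \<and>
     (\<forall>r \<in> {0..1}. \<forall>x \<in> ea_carrier E. f (smul r x) = smul' r (f x))"

section \<open>Order unit spaces\<close>

definition cone_le :: "'v::real_vector set \<Rightarrow> 'v \<Rightarrow> 'v \<Rightarrow> bool" where
  "cone_le C v w \<longleftrightarrow> w - v \<in> C"

definition order_unit_norm :: "'v::real_vector set \<Rightarrow> 'v \<Rightarrow> 'v \<Rightarrow> real" where
  "order_unit_norm C u v =
     Inf {r. r > 0 \<and> cone_le C (- (r *\<^sub>R u)) v \<and> cone_le C v (r *\<^sub>R u)}"

definition order_unit_dist :: "'v::real_vector set \<Rightarrow> 'v \<Rightarrow> 'v \<Rightarrow> 'v \<Rightarrow> real" where
  "order_unit_dist C u v w = order_unit_norm C u (v - w)"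

locale order_unit_space =
  fixes C :: "'v::real_vector set" and u :: 'v
  assumes cone: "convex_cone C"
    and proper: "C \<inter> uminus ` C = {0}"
    and spanning: "span C = UNIV"
    and order_unit: "\<exists>n::nat. cone_le C (- (real n *\<^sub>R u)) v \<and> cone_le C v (real n *\<^sub>R u)"
    and archimedean: "(\<And>n::nat. n \<ge> 1 \<Longrightarrow> cone_le C v ((1 / real n) *\<^sub>R u)) \<Longrightarrow> cone_le C v 0"
begin

lemma add_mem: "\<lbrakk>x \<in> C; y \<in> C\<rbrakk> \<Longrightarrow> x + y \<in> C"
  using cone convex_cone_add by blast

lemma scale_mem: "\<lbrakk>0 \<le> r; x \<in> C\<rbrakk> \<Longrightarrow> r *\<^sub>R x \<in> C"
  using cone convex_cone_scaleR by blast

lemma zero_mem: "0 \<in> C"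
  using proper by blast

lemma unit_mem: "u \<in> C"
proof -
  obtain n :: nat where n: "cone_le C (- (real n *\<^sub>R u)) u"
    using order_unit by blast
  have "(1 / (1 + real n)) *\<^sub>R ((1 + real n) *\<^sub>R u) \<in> C"
    by (rule scale_mem) (use n in \<open>auto simp: cone_le_def algebra_simps\<close>)
  then show ?thesis by simp
qed

abbreviation bounds :: "'v \<Rightarrow> real set" where
  "bounds v \<equiv> {r. r > 0 \<and> cone_le C (- (r *\<^sub>R u)) v \<and> cone_le C v (r *\<^sub>R u)}"

lemma bounds_mono: "\<lbrakk>r \<in> bounds v; r \<le> s\<rbrakk> \<Longrightarrow> s \<in> bounds v"
proof -
  assume r: "r \<in> bounds v" and "r \<le> s"
  then have d: "(s - r) *\<^sub>R u \<in> C"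
    using scale_mem unit_mem by simp
  have "(s - r) *\<^sub>R u + (v + r *\<^sub>R u) \<in> C" "(s - r) *\<^sub>R u + (r *\<^sub>R u - v) \<in> C"
    by (rule add_mem[OF d]; use r in \<open>simp add: cone_le_def\<close>)+
  then show ?thesis
    using r \<open>r \<le> s\<close> by (simp add: cone_le_def algebra_simps)
qed

lemma bounds_nonempty: "bounds v \<noteq> {}"
proof -
  obtain n :: nat where n: "cone_le C (- (real n *\<^sub>R u)) v" "cone_le C v (real n *\<^sub>R u)"
    using order_unit by blast
  have "u + (v + real n *\<^sub>R u) \<in> C" "u + (real n *\<^sub>R u - v) \<in> C"
    by (rule add_mem[OF unit_mem]; use n in \<open>simp add: cone_le_def\<close>)+
  then have "real n + 1 \<in> bounds v"
    by (simp add: cone_le_def algebra_simps)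
  then show ?thesis by blast
qed

lemma bounds_below: "bdd_below (bounds v)"
  by (rule bdd_belowI[of _ 0]) auto

lemma norm_nonneg: "0 \<le> order_unit_norm C u v"
  unfolding order_unit_norm_def by (rule cInf_greatest[OF bounds_nonempty]) auto

lemma norm_less_imp_bounds: "order_unit_norm C u v < r \<Longrightarrow> r \<in> bounds v"
  unfolding order_unit_norm_def
  using bounds_mono cInf_lessD[OF bounds_nonempty[of v]] by (metis (no_types, lifting) less_imp_le)

lemma bounds_imp_norm_le: "r \<in> bounds v \<Longrightarrow> order_unit_norm C u v \<le> r"
  unfolding order_unit_norm_def by (rule cInf_lower[OF _ bounds_below])

lemma norm_minus: "order_unit_norm C u (- v) = order_unit_norm C u v"
  unfolding order_unit_norm_def cone_le_def
  by (rule arg_cong[where f = Inf]) (auto simp: add.commute)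

lemma norm_triangle:
  "order_unit_norm C u (v + w) \<le> order_unit_norm C u v + order_unit_norm C u w"
proof (rule field_le_epsilon)
  fix e :: real assume "e > 0"
  define r where "r = order_unit_norm C u v + e / 2"
  define s where "s = order_unit_norm C u w + e / 2"
  have r: "r \<in> bounds v" and s: "s \<in> bounds w"
    using \<open>e > 0\<close> by (auto simp: r_def s_def intro!: norm_less_imp_bounds simp del: mem_Collect_eq)
  have "(v + r *\<^sub>R u) + (w + s *\<^sub>R u) \<in> C" "(r *\<^sub>R u - v) + (s *\<^sub>R u - w) \<in> C"
    by (rule add_mem; use r s in \<open>simp add: cone_le_def\<close>)+
  moreover have "r + s > 0" using r s by auto
  ultimately have "r + s \<in> bounds (v + w)"
    by (simp add: cone_le_def algebra_simps)
  from bounds_imp_norm_le[OF this]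
  show "order_unit_norm C u (v + w) \<le> order_unit_norm C u v + order_unit_norm C u w + e"
    by (simp add: r_def s_def)
qed

lemma norm_eq_0_iff: "order_unit_norm C u v = 0 \<longleftrightarrow> v = 0"
proof
  assume z: "order_unit_norm C u v = 0"
  have b: "1 / real n \<in> bounds v" if "n \<ge> 1" for n :: nat
    using z that by (intro norm_less_imp_bounds) simp
  have "cone_le C v 0"
    by (rule archimedean) (use b in auto)
  moreover have "cone_le C (- v) 0"
    by (rule archimedean) (use b in \<open>auto simp: cone_le_def add.commute\<close>)
  ultimately have "v \<in> C \<inter> uminus ` C"
    by (force simp: cone_le_def image_iff intro: bexI[of _ "- v"])
  then show "v = 0" using proper by simp
next
  assume "v = 0"
  have "order_unit_norm C u v \<le> 0 + e" if "e > 0" for e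
  proof -
    have "e \<in> bounds v"
      using that \<open>v = 0\<close> scale_mem[OF _ unit_mem, of e] by (simp add: cone_le_def)
    then show ?thesis using bounds_imp_norm_le by simp
  qed
  then show "order_unit_norm C u v = 0"
    using norm_nonneg[of v] field_le_epsilon[of "order_unit_norm C u v" 0] by simp
qed

sublocale Metric_space UNIV "order_unit_dist C u"
proof
  fix x y z :: 'v
  show "0 \<le> order_unit_dist C u x y"
    by (simp add: order_unit_dist_def norm_nonneg)
  show "order_unit_dist C u x y = order_unit_dist C u y x"
    unfolding order_unit_dist_def by (metis minus_diff_eq norm_minus)
  show "order_unit_dist C u x y = 0 \<longleftrightarrow> x = y"
    by (simp add: order_unit_dist_def norm_eq_0_iff)
  show "order_unit_dist C u x z \<le> order_unit_dist C u x y + order_unit_dist C u y z"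
    unfolding order_unit_dist_def using norm_triangle[of "x - y" "y - z"] by simp
qed

text \<open>The effect algebra \<open>{v. 0 \<le> v \<le> u}\<close>, with sums defined when they are below the unit.\<close>

definition unit_interval :: "'v ea" where
  "unit_interval =
     \<lparr>ea_carrier = {v. cone_le C 0 v \<and> cone_le C v u}, ea_zero = 0, ea_one = u,
      ea_summable = (\<lambda>v w. cone_le C (v + w) u), ea_add = (+)\<rparr>"

definition order_isomorphism :: "('v \<Rightarrow> 'v) \<Rightarrow> bool" where
  "order_isomorphism \<Phi> \<longleftrightarrow> linear \<Phi> \<and> bij \<Phi> \<and> (\<forall>v. v \<in> C \<longleftrightarrow> \<Phi> v \<in> C)"

text \<open>The topology is the one induced by the order unit norm.\<close>

definition homogeneous_cone :: bool where
  "homogeneous_cone \<longleftrightarrow>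
     (\<forall>a \<in> mtopology interior_of C. \<forall>b \<in> mtopology interior_of C.
        \<exists>\<Phi>. order_isomorphism \<Phi> \<and> \<Phi> a = b)"

end

text \<open>
  The order unit space associated with a convex effect algebra is determined only up to
  isomorphism, so it is treated as a relation: any order unit space \<open>(V, C, u)\<close> whose unit
  interval is isomorphic to the given algebra qualifies.
\<close>

definition associated_order_unit_space ::
  "'e ea \<Rightarrow> (real \<Rightarrow> 'e \<Rightarrow> 'e) \<Rightarrow> 'v::real_vector set \<Rightarrow> 'v \<Rightarrow> bool" where
  "associated_order_unit_space E smul C u \<longleftrightarrow>
     order_unit_space C u \<and>
     (\<exists>f. convex_ea_iso f E smul (order_unit_space.unit_interval C u) (*\<^sub>R))"

end

theory Submission
  imports Defs
begin

text \<open>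
  It suffices to map the unit \<open>u\<close> to an arbitrary interior point \<open>a\<close>, which may be scaled so that
  \<open>u / N \<le> a \<le> u\<close>. Left multiplication by \<open>a\<close> extends to a positive linear map sending \<open>u\<close> to \<open>a\<close>.
  It is invertible as soon as some effect \<open>s\<close> commuting with \<open>a\<close> satisfies \<open>a \<odot> s = u / N\<close>,
  because then \<open>a \<odot> (s \<odot> x) = (a \<odot> s) \<odot> x = x / N\<close>. Writing \<open>b = u - a\<close>, this equation becomes
  the fixed point equation \<open>s = u / N + b \<odot> s\<close>; the monotone iteration from \<open>0\<close> stays in the
  commutant of \<open>b\<close> and its limit solves it by \<open>\<sigma>\<close>-continuity of \<open>b \<odot> -\<close>.
\<close>

section \<open>Effects and the interior of the cone\<close>

context order_unit_space
begin

text \<open>The carrier of \<open>unit_interval\<close>, expressed by cone membership so that order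
  arguments become closure properties of \<open>C\<close>.\<close>

definition effects :: "'v set" where
  "effects = {v. v \<in> C \<and> u - v \<in> C}"

lemma effectsI: "\<lbrakk>v \<in> C; u - v \<in> C\<rbrakk> \<Longrightarrow> v \<in> effects"
  by (simp add: effects_def)

lemma effects_in_cone: "v \<in> effects \<Longrightarrow> v \<in> C"
  by (simp add: effects_def)

lemma effects_le_unit: "v \<in> effects \<Longrightarrow> u - v \<in> C"
  by (simp add: effects_def)

lemma zero_effect: "0 \<in> effects"
  by (simp add: effects_def zero_mem unit_mem)

lemma unit_effect: "u \<in> effects"
  by (simp add: effects_def zero_mem unit_mem)

lemma compl_effect: "v \<in> effects \<Longrightarrow> u - v \<in> effects"
  by (simp add: effects_def)

lemma diff_trans: "\<lbrakk>z - y \<in> C; y - x \<in> C\<rbrakk> \<Longrightarrow> z - x \<in> C"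
  using add_mem[of "z - y" "y - x"] by simp

lemma cone_antisym: "\<lbrakk>x - y \<in> C; y - x \<in> C\<rbrakk> \<Longrightarrow> x = y"
proof -
  assume "x - y \<in> C" "y - x \<in> C"
  then have "x - y \<in> C \<inter> uminus ` C"
    by (auto simp: image_iff intro!: bexI[of _ "y - x"])
  then show ?thesis using proper by auto
qed

lemma below_effect: "\<lbrakk>x \<in> C; y \<in> effects; y - x \<in> C\<rbrakk> \<Longrightarrow> x \<in> effects"
  by (meson diff_trans effectsI effects_in_cone effects_le_unit)

lemma scale_effect: "\<lbrakk>0 \<le> r; r \<le> 1; v \<in> effects\<rbrakk> \<Longrightarrow> r *\<^sub>R v \<in> effects"
proof -
  assume *: "0 \<le> r" "r \<le> 1" "v \<in> effects"
  have "(1 - r) *\<^sub>R v \<in> C"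
    using * scale_mem effects_in_cone by simp
  then have "v - r *\<^sub>R v \<in> C" by (simp add: algebra_simps)
  then show ?thesis
    using * below_effect scale_mem effects_in_cone by blast
qed

lemma convex_effect:
  "\<lbrakk>0 \<le> p; 0 \<le> q; p + q = 1; x \<in> effects; y \<in> effects\<rbrakk> \<Longrightarrow> p *\<^sub>R x + q *\<^sub>R y \<in> effects"
proof -
  assume *: "0 \<le> p" "0 \<le> q" "p + q = 1" "x \<in> effects" "y \<in> effects"
  have "p *\<^sub>R x + q *\<^sub>R y \<in> C" "p *\<^sub>R (u - x) + q *\<^sub>R (u - y) \<in> C"
    by (intro add_mem scale_mem; use * in \<open>simp add: effects_def\<close>)+
  moreover have "p *\<^sub>R (u - x) + q *\<^sub>R (u - y) = (p + q) *\<^sub>R u - (p *\<^sub>R x + q *\<^sub>R y)"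
    by (simp add: algebra_simps)
  ultimately show ?thesis using * by (simp add: effectsI)
qed

text \<open>Any order unit bound \<open>r\<close> of \<open>v\<close> gives
  \<open>v \<le> r u\<close>, so division by \<open>r\<close> lands in the unit interval.\<close>

lemma cone_scaled_effect:
  assumes "v \<in> C"
  obtains r x where "r > 0" "x \<in> effects" "v = r *\<^sub>R x"
proof -
  obtain r where r: "r \<in> bounds v"
    using bounds_nonempty by blast
  have "(1 / r) *\<^sub>R v \<in> C" "(1 / r) *\<^sub>R (r *\<^sub>R u - v) \<in> C"
    by (rule scale_mem; use r assms in \<open>simp add: cone_le_def\<close>)+
  then have "(1 / r) *\<^sub>R v \<in> effects"
    using r by (simp add: effectsI algebra_simps)
  with r show ?thesis by (intro that[of r "(1 / r) *\<^sub>R v"]) auto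
qed

text \<open>This normal form is what makes a map on effects extendable to the whole space. It comes
  from writing \<open>v\<close> as \<open>(v + r u) - r u\<close>, a difference of two cone
  elements.\<close>

lemma vector_scaled_diff:
  obtains r x y where "r > 0" "x \<in> effects" "y \<in> effects" "v = r *\<^sub>R (x - y)"
proof -
  obtain r where r: "r \<in> bounds v"
    using bounds_nonempty by blast
  then have "v + r *\<^sub>R u \<in> C" by (simp add: cone_le_def)
  then obtain s x where s: "s > 0" "x \<in> effects" "v + r *\<^sub>R u = s *\<^sub>R x"
    using cone_scaled_effect by metis
  have rs: "r > 0" "r + s > 0" using r s by auto
  have "v = s *\<^sub>R x - r *\<^sub>R u"
    by (simp add: s(3)[symmetric])
  \<comment> \<open>The common scale \<open>r + s\<close> makes both coefficients at most 1, so both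
    terms remain effects.\<close>
  also have "\<dots> = (r + s) *\<^sub>R ((s / (r + s)) *\<^sub>R x - (r / (r + s)) *\<^sub>R u)"
    using rs by (simp add: scaleR_diff_right)
  finally show ?thesis
    using rs s
    by (intro that[of "r + s" "(s / (r + s)) *\<^sub>R x" "(r / (r + s)) *\<^sub>R u"] scale_effect unit_effect)
      auto
qed

lemma infinitesimal_zero:
  assumes "\<And>n::nat. n \<ge> 1 \<Longrightarrow> (1 / real n) *\<^sub>R u - d \<in> C"
    and "\<And>n::nat. n \<ge> 1 \<Longrightarrow> (1 / real n) *\<^sub>R u + d \<in> C"
  shows "d = 0"
proof -
  have "cone_le C d 0" "cone_le C (- d) 0"
    by (rule archimedean; use assms in \<open>simp add: cone_le_def\<close>)+
  then show ?thesis
    using cone_antisym[of 0 d] by (simp add: cone_le_def)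
qed

lemma interior_above_unit:
  assumes "a \<in> mtopology interior_of C"
  obtains e where "e > 0" "a - e *\<^sub>R u \<in> C"
proof -
  obtain r where r: "r > 0" "mball a r \<subseteq> C"
    using assms in_interior_of_mball by blast
  \<comment> \<open>Half the radius is taken because the ball is open: the shift by
    \<open>(r / 2) u\<close> has norm at most \<open>r / 2 < r\<close>.\<close>
  have "r / 2 \<in> bounds ((r / 2) *\<^sub>R u)"
    using r scale_mem[OF _ unit_mem, of r] by (simp add: cone_le_def zero_mem flip: scaleR_left_distrib)
  then have "a - (r / 2) *\<^sub>R u \<in> mball a r"
    using bounds_imp_norm_le r by (force simp: order_unit_dist_def)
  with r show ?thesis by (intro that[of "r / 2"]) auto
qed

section \<open>Order isomorphisms and reduction to the orbit of the unit\<close>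

lemma order_isomorphism_comp:
  "\<lbrakk>order_isomorphism \<Phi>; order_isomorphism \<Psi>\<rbrakk> \<Longrightarrow> order_isomorphism (\<Phi> \<circ> \<Psi>)"
proof -
  assume iso: "order_isomorphism \<Phi>" "order_isomorphism \<Psi>"
  then have "v \<in> C \<longleftrightarrow> (\<Phi> \<circ> \<Psi>) v \<in> C" for v
    unfolding order_isomorphism_def comp_apply by blast
  with iso show ?thesis
    unfolding order_isomorphism_def by (blast intro: linear_compose bij_comp)
qed

lemma order_isomorphism_inv:
  "order_isomorphism \<Phi> \<Longrightarrow> order_isomorphism (inv \<Phi>)"
proof -
  assume iso: "order_isomorphism \<Phi>"
  then have bij: "bij \<Phi>" and lin: "linear \<Phi>" and pos: "\<And>v. v \<in> C \<longleftrightarrow> \<Phi> v \<in> C"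
    unfolding order_isomorphism_def by blast+
  have "linear (inv \<Phi>)"
  proof (rule linearI)
    fix v w :: 'v and c :: real
    show "inv \<Phi> (v + w) = inv \<Phi> v + inv \<Phi> w"
      by (rule inv_f_eq[OF bij_is_inj[OF bij]])
        (simp add: linear_add[OF lin] surj_f_inv_f[OF bij_is_surj[OF bij]])
    show "inv \<Phi> (c *\<^sub>R v) = c *\<^sub>R inv \<Phi> v"
      by (rule inv_f_eq[OF bij_is_inj[OF bij]])
        (simp add: linear_cmul[OF lin] surj_f_inv_f[OF bij_is_surj[OF bij]])
  qed
  moreover have "v \<in> C \<longleftrightarrow> inv \<Phi> v \<in> C" for v
    using pos[of "inv \<Phi> v"] surj_f_inv_f[OF bij_is_surj[OF bij]] by simp
  ultimately show ?thesis
    unfolding order_isomorphism_def using bij_imp_bij_inv[OF bij] by blast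
qed

lemma order_isomorphism_scale:
  assumes "r > 0" shows "order_isomorphism ((*\<^sub>R) r)"
proof -
  have "v \<in> C" if "r *\<^sub>R v \<in> C" for v
    using scale_mem[OF _ that, of "1 / r"] assms by simp
  moreover have "bij ((*\<^sub>R) r :: 'v \<Rightarrow> 'v)"
    using assms by (intro o_bij[where g = "(*\<^sub>R) (1 / r)"]) auto
  moreover have "r *\<^sub>R v \<in> C" if "v \<in> C" for v
    using scale_mem that assms by simp
  moreover have "linear ((*\<^sub>R) r :: 'v \<Rightarrow> 'v)"
    by (rule linear_scale_self)
  ultimately show ?thesis
    unfolding order_isomorphism_def by blast
qed

text \<open>Any two interior points are joined through \<open>u\<close>: go from \<open>a\<close>
  back to \<open>u\<close>, then on to \<open>b\<close>.\<close>

lemma homogeneous_coneI: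
  assumes "\<And>a. a \<in> mtopology interior_of C \<Longrightarrow> \<exists>\<Phi>. order_isomorphism \<Phi> \<and> \<Phi> u = a"
  shows homogeneous_cone
  unfolding homogeneous_cone_def
proof (intro ballI)
  fix a b assume "a \<in> mtopology interior_of C" "b \<in> mtopology interior_of C"
  then obtain \<Phi> \<Psi> where *: "order_isomorphism \<Phi>" "\<Phi> u = a" "order_isomorphism \<Psi>" "\<Psi> u = b"
    using assms by meson
  then have "inv \<Phi> a = u"
    by (metis bij_is_inj inv_f_f order_isomorphism_def)
  with * show "\<exists>\<Phi>. order_isomorphism \<Phi> \<and> \<Phi> a = b"
    by (intro exI[of _ "\<Psi> \<circ> inv \<Phi>"]) (simp add: order_isomorphism_comp order_isomorphism_inv)
qed

text \<open>Lower bounds compete only among effects, as in \<open>ea_is_inf\<close>; that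
  \<open>x\<close> is itself an effect is recorded separately.\<close>

definition effect_inf :: "(nat \<Rightarrow> 'v) \<Rightarrow> 'v \<Rightarrow> bool" where
  "effect_inf t x \<longleftrightarrow>
     (\<forall>i. t i - x \<in> C) \<and> (\<forall>y \<in> effects. (\<forall>i. t i - y \<in> C) \<longrightarrow> x - y \<in> C)"

end

section \<open>Extending additive maps of effects\<close>

text \<open>Abstracts left multiplication by a fixed effect, for which only additivity is
  postulated; homogeneity over the reals has to be derived.\<close>

locale additive_effect_map = order_unit_space C u for C :: "'v::real_vector set" and u :: 'v +
  fixes L :: "'v \<Rightarrow> 'v"
  assumes L_closed: "x \<in> effects \<Longrightarrow> L x \<in> effects"
    and L_add: "\<lbrakk>x \<in> effects; y \<in> effects; x + y \<in> effects\<rbrakk> \<Longrightarrow> L (x + y) = L x + L y"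
begin

lemma L_zero: "L 0 = 0"
  using L_add[OF zero_effect zero_effect] zero_effect by simp

text \<open>The difference \<open>y - x\<close> is an effect, and by additivity its image is
  \<open>L y - L x\<close>.\<close>

lemma L_mono:
  assumes "x \<in> effects" "y \<in> effects" "y - x \<in> C"
  shows "L y - L x \<in> C"
proof -
  have "y - (y - x) \<in> C"
    using assms effects_in_cone by simp
  then have "y - x \<in> effects"
    using assms below_effect by blast
  then show ?thesis
    using L_add[of x "y - x"] L_closed[of "y - x"] assms effects_in_cone by simp
qed

lemma L_nat:
  assumes "x \<in> effects" "real k *\<^sub>R x \<in> effects"
  shows "L (real k *\<^sub>R x) = real k *\<^sub>R L x"
  using assms(2)
proof (induction k)
  case 0
  then show ?case by (simp add: L_zero)
next
  case (Suc k)
  \<comment> \<open>Shrinking the full multiple shows that the shorter one is an effect, as the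
    induction hypothesis and \<open>L_add\<close> require.\<close>
  have "(real k / real (Suc k)) *\<^sub>R (real (Suc k) *\<^sub>R x) \<in> effects"
    by (intro scale_effect Suc.prems) (auto simp: field_simps)
  then have "real k *\<^sub>R x \<in> effects" by simp
  with Suc assms(1) L_add[of x "real k *\<^sub>R x"] show ?case
    by (simp add: algebra_simps)
qed

lemma L_fraction:
  assumes "x \<in> effects" "n \<ge> 1" "k \<le> n"
  shows "L ((real k / real n) *\<^sub>R x) = (real k / real n) *\<^sub>R L x"
proof -
  have y: "(1 / real n) *\<^sub>R x \<in> effects"
    using assms by (intro scale_effect) auto
  have "L x = real n *\<^sub>R L ((1 / real n) *\<^sub>R x)"
    using L_nat[OF y, of n] assms by simp
  moreover have "L ((real k / real n) *\<^sub>R x) = real k *\<^sub>R L ((1 / real n) *\<^sub>R x)"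
    using L_nat[OF y, of k] scale_effect[of "real k / real n" x] assms by simp
  ultimately show ?thesis using assms by simp
qed

text \<open>Monotonicity traps \<open>L (r x)\<close> between the values at neighbouring fractions
  \<open>k / n\<close> and \<open>(k + 1) / n\<close>. Its distance from \<open>r L x\<close> is
  then at most \<open>u / n\<close> in both directions, and the Archimedean property removes the
  error.\<close>

lemma L_scale:
  assumes x: "x \<in> effects" and r: "0 \<le> r" "r \<le> 1"
  shows "L (r *\<^sub>R x) = r *\<^sub>R L x"
proof (cases "r = 1")
  \<comment> \<open>Excluding \<open>r = 1\<close> keeps the upper fraction
    \<open>(k + 1) / n\<close> at most 1.\<close>
  case False
  have Lx: "L x \<in> C" "u - L x \<in> C"
    using L_closed[OF x] by (auto simp: effects_def)
  have "(1 / real n) *\<^sub>R u - (L (r *\<^sub>R x) - r *\<^sub>R L x) \<in> C \<and>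
        (1 / real n) *\<^sub>R u + (L (r *\<^sub>R x) - r *\<^sub>R L x) \<in> C" if n: "n \<ge> 1" for n :: nat
  proof -
    define k where "k = nat \<lfloor>r * real n\<rfloor>"
    have k: "real k \<le> r * real n" "r * real n < real k + 1"
      using r by (auto simp: k_def)
    have "r * real n < real n"
      using r False n by simp
    with k have kn: "Suc k \<le> n" by linarith
    have lo: "real k / real n \<le> r" and hi: "r \<le> real (Suc k) / real n"
      using k n by (auto simp: field_simps)
    have diff: "real (Suc k) / real n = real k / real n + 1 / real n"
      by (simp add: add_divide_distrib)
    have eff: "(real k / real n) *\<^sub>R x \<in> effects" "(real (Suc k) / real n) *\<^sub>R x \<in> effects"
      "r *\<^sub>R x \<in> effects"
      using n kn r by (intro scale_effect x; simp)+
    have "r *\<^sub>R x - (real k / real n) *\<^sub>R x \<in> C"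
      using scale_mem[of "r - real k / real n" x] lo x effects_in_cone
      by (simp add: algebra_simps)
    from L_mono[OF eff(1,3) this] have 1: "L (r *\<^sub>R x) - (real k / real n) *\<^sub>R L x \<in> C"
      using L_fraction[OF x, of n k] n kn by simp
    have "(real (Suc k) / real n) *\<^sub>R x - r *\<^sub>R x \<in> C"
      using scale_mem[of "real (Suc k) / real n - r" x] hi x effects_in_cone
      by (simp only: scaleR_diff_left)
    from L_mono[OF eff(3,2) this] have 2: "(real (Suc k) / real n) *\<^sub>R L x - L (r *\<^sub>R x) \<in> C"
      using L_fraction[OF x, of n "Suc k"] n kn by simp
    have 3: "(1 / real n) *\<^sub>R (u - L x) \<in> C"
      using scale_mem Lx by simp
    have 4: "(r - real k / real n) *\<^sub>R L x \<in> C"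
      using scale_mem lo Lx by simp
    have 5: "(real (Suc k) / real n - r) *\<^sub>R L x \<in> C"
      using scale_mem hi Lx by (simp del: of_nat_Suc)
    \<comment> \<open>The margin \<open>u / n\<close> is split as
      \<open>(u - L x) / n + L x / n\<close>; the second half pays for the gap between the two
      fractions.\<close>
    have "(1 / real n) *\<^sub>R u - (L (r *\<^sub>R x) - r *\<^sub>R L x) =
      ((real (Suc k) / real n) *\<^sub>R L x - L (r *\<^sub>R x)) + ((1 / real n) *\<^sub>R (u - L x)
        + (r - real k / real n) *\<^sub>R L x)"
      unfolding diff by (simp add: algebra_simps)
    moreover have "(1 / real n) *\<^sub>R u + (L (r *\<^sub>R x) - r *\<^sub>R L x) =
      (L (r *\<^sub>R x) - (real k / real n) *\<^sub>R L x) + ((1 / real n) *\<^sub>R (u - L x)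
        + (real (Suc k) / real n - r) *\<^sub>R L x)"
      unfolding diff by (simp add: algebra_simps)
    ultimately show ?thesis
      using add_mem 1 2 3 4 5 by presburger
  qed
  then have "L (r *\<^sub>R x) - r *\<^sub>R L x = 0"
    by (intro infinitesimal_zero) blast+
  then show ?thesis by simp
qed simp

lemma L_convex:
  assumes "0 \<le> p" "0 \<le> q" "p + q = 1" "x \<in> effects" "y \<in> effects"
  shows "L (p *\<^sub>R x + q *\<^sub>R y) = p *\<^sub>R L x + q *\<^sub>R L y"
proof -
  have "p \<le> 1" "q \<le> 1" using assms by linarith+
  then show ?thesis
    using L_add[OF scale_effect[of p x] scale_effect[of q y] convex_effect[OF assms]]
      L_scale[of x p] L_scale[of y q] assms by presburger
qed

lemma scaled_L_well_defined:
  assumes "r > 0" "s > 0" and xy: "x \<in> effects" "y \<in> effects" "x' \<in> effects" "y' \<in> effects"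
    and eq: "r *\<^sub>R (x - y) = s *\<^sub>R (x' - y')"
  shows "r *\<^sub>R (L x - L y) = s *\<^sub>R (L x' - L y')"
proof -
  \<comment> \<open>Dividing by \<open>r + s\<close> and moving the negative terms across turns the
    equation into one between convex combinations of effects, which \<open>L\<close>
    respects.\<close>
  define p q where "p = r / (r + s)" and "q = s / (r + s)"
  have pq: "0 \<le> p" "0 \<le> q" "p + q = 1" "r = (r + s) * p" "s = (r + s) * q"
    using assms(1,2) by (auto simp: p_def q_def simp flip: add_divide_distrib)
  have "(r + s) *\<^sub>R (p *\<^sub>R (x - y)) = (r + s) *\<^sub>R (q *\<^sub>R (x' - y'))"
    using eq pq(4,5) by simp
  then have "p *\<^sub>R (x - y) = q *\<^sub>R (x' - y')"
    using assms(1,2) by (subst (asm) real_vector.scale_cancel_left) auto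
  then have "p *\<^sub>R x + q *\<^sub>R y' = p *\<^sub>R y + q *\<^sub>R x'"
    by (simp add: algebra_simps)
  then have "p *\<^sub>R L x + q *\<^sub>R L y' = p *\<^sub>R L y + q *\<^sub>R L x'"
    using L_convex[OF pq(1-3)] xy by metis
  then have "p *\<^sub>R (L x - L y) = q *\<^sub>R (L x' - L y')"
    by (simp add: algebra_simps)
  then show ?thesis
    using pq(4,5) by (metis scaleR_scaleR)
qed

text \<open>The description operator avoids choosing a representation of \<open>v\<close>;
  uniqueness of the value is \<open>scaled_L_well_defined\<close>.\<close>

definition extension :: "'v \<Rightarrow> 'v" where
  "extension v = (THE w. \<exists>r>0. \<exists>x\<in>effects. \<exists>y\<in>effects.
      v = r *\<^sub>R (x - y) \<and> w = r *\<^sub>R (L x - L y))"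

lemma extension_scaled_diff:
  assumes "r > 0" "x \<in> effects" "y \<in> effects"
  shows "extension (r *\<^sub>R (x - y)) = r *\<^sub>R (L x - L y)"
  unfolding extension_def
proof (rule the_equality)
  show "\<exists>s>0. \<exists>x'\<in>effects. \<exists>y'\<in>effects.
      r *\<^sub>R (x - y) = s *\<^sub>R (x' - y') \<and> r *\<^sub>R (L x - L y) = s *\<^sub>R (L x' - L y')"
    using assms by blast
qed (use assms scaled_L_well_defined in metis)

lemma extension_effect: "x \<in> effects \<Longrightarrow> extension x = L x"
  using extension_scaled_diff[of 1 x 0] zero_effect L_zero by simp

lemma extension_linear: "linear extension"
proof (rule linearI)
  fix v w
  obtain r x y where v: "r > 0" "x \<in> effects" "y \<in> effects" "v = r *\<^sub>R (x - y)"
    using vector_scaled_diff by metis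
  obtain s x' y' where w: "s > 0" "x' \<in> effects" "y' \<in> effects" "w = s *\<^sub>R (x' - y')"
    using vector_scaled_diff by metis
  \<comment> \<open>At the common scale \<open>r + s\<close>, the sum \<open>v + w\<close> is again
    a scaled difference of two effects, each a convex combination.\<close>
  define p q where "p = r / (r + s)" and "q = s / (r + s)"
  have pq: "0 \<le> p" "0 \<le> q" "p + q = 1" "(r + s) * p = r" "(r + s) * q = s"
    using v(1) w(1) by (auto simp: p_def q_def simp flip: add_divide_distrib)
  have split: "(r + s) *\<^sub>R ((p *\<^sub>R a + q *\<^sub>R b) - (p *\<^sub>R c + q *\<^sub>R d))
      = r *\<^sub>R (a - c) + s *\<^sub>R (b - d)" for a b c d :: 'v
    unfolding scaleR_diff_right scaleR_add_right scaleR_scaleR pq(4,5) by simp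
  show "extension (v + w) = extension v + extension w"
    using extension_scaled_diff[of "r + s" "p *\<^sub>R x + q *\<^sub>R x'" "p *\<^sub>R y + q *\<^sub>R y'"]
      v w L_convex[OF pq(1-3)] convex_effect[OF pq(1-3)] extension_scaled_diff
    by (simp add: split)
next
  fix c :: real and v
  obtain r x y where v: "r > 0" "x \<in> effects" "y \<in> effects" "v = r *\<^sub>R (x - y)"
    using vector_scaled_diff by metis
  consider "c = 0" | "c > 0" | "c < 0" by linarith
  then show "extension (c *\<^sub>R v) = c *\<^sub>R extension v"
  proof cases
    case 1
    then show ?thesis using extension_effect[OF zero_effect] L_zero by simp
  next
    case 2
    then show ?thesis
      using extension_scaled_diff[of "c * r" x y] extension_scaled_diff[of r x y] v by simp
  next
    case 3
    \<comment> \<open>Representations need a positive scale, so the sign of \<open>c\<close> is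
      absorbed by exchanging \<open>x\<close> and \<open>y\<close>.\<close>
    have "c *\<^sub>R v = (- c * r) *\<^sub>R (y - x)"
      unfolding v(4) by (simp add: algebra_simps)
    moreover have "- c * r > 0" using 3 v(1) by (simp add: mult_neg_pos)
    ultimately have "extension (c *\<^sub>R v) = (- c * r) *\<^sub>R (L y - L x)"
      using extension_scaled_diff[of "- c * r" y x] v by simp
    also have "\<dots> = c *\<^sub>R (r *\<^sub>R (L x - L y))" by (simp add: algebra_simps)
    also have "\<dots> = c *\<^sub>R extension v" using extension_scaled_diff[of r x y] v by simp
    finally show ?thesis .
  qed
qed

lemma extension_positive: "v \<in> C \<Longrightarrow> extension v \<in> C"
proof -
  assume "v \<in> C"
  then obtain r x where "r > 0" "x \<in> effects" "v = r *\<^sub>R x"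
    using cone_scaled_effect by metis
  then show ?thesis
    using scale_mem effects_in_cone L_closed
    by (simp add: linear_cmul[OF extension_linear] extension_effect)
qed

end

section \<open>The sequential product on the unit interval\<close>

text \<open>The product axioms read on effects of \<open>V\<close>. The three axioms on infima are
  bundled in \<open>descending_inf\<close>, so that they concern one and the same limit
  \<open>x\<close>.\<close>

locale effect_product = order_unit_space C u for C :: "'v::real_vector set" and u :: 'v +
  fixes sp :: "'v \<Rightarrow> 'v \<Rightarrow> 'v" (infixl "\<odot>" 70)
  assumes sp_closed: "\<lbrakk>a \<in> effects; b \<in> effects\<rbrakk> \<Longrightarrow> a \<odot> b \<in> effects"
    and sp_add: "\<lbrakk>a \<in> effects; b \<in> effects; c \<in> effects; b + c \<in> effects\<rbrakk>
          \<Longrightarrow> a \<odot> (b + c) = a \<odot> b + a \<odot> c"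
    and unit_sp: "a \<in> effects \<Longrightarrow> u \<odot> a = a"
    and sp_zero_sym: "\<lbrakk>a \<in> effects; b \<in> effects; a \<odot> b = 0\<rbrakk> \<Longrightarrow> b \<odot> a = 0"
    and comm_compl: "\<lbrakk>a \<in> effects; b \<in> effects; a \<odot> b = b \<odot> a\<rbrakk>
          \<Longrightarrow> a \<odot> (u - b) = (u - b) \<odot> a"
    and comm_assoc: "\<lbrakk>a \<in> effects; b \<in> effects; c \<in> effects; a \<odot> b = b \<odot> a\<rbrakk>
          \<Longrightarrow> a \<odot> (b \<odot> c) = (a \<odot> b) \<odot> c"
    and comm_sp: "\<lbrakk>a \<in> effects; b \<in> effects; c \<in> effects; c \<odot> a = a \<odot> c; c \<odot> b = b \<odot> c\<rbrakk>
          \<Longrightarrow> c \<odot> (a \<odot> b) = (a \<odot> b) \<odot> c"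
    and comm_add: "\<lbrakk>a \<in> effects; b \<in> effects; c \<in> effects; a + b \<in> effects;
            c \<odot> a = a \<odot> c; c \<odot> b = b \<odot> c\<rbrakk> \<Longrightarrow> c \<odot> (a + b) = (a + b) \<odot> c"
    and descending_inf: "\<lbrakk>\<And>i. t i \<in> effects; \<And>i. t i - t (Suc i) \<in> C\<rbrakk>
          \<Longrightarrow> \<exists>x \<in> effects. effect_inf t x \<and>
                (\<forall>b \<in> effects. effect_inf (\<lambda>i. b \<odot> t i) (b \<odot> x) \<and>
                  ((\<forall>i. b \<odot> t i = t i \<odot> b) \<longrightarrow> b \<odot> x = x \<odot> b))"
begin

lemma sp_additive: "a \<in> effects \<Longrightarrow> additive_effect_map C u ((\<odot>) a)"
  by unfold_locales (simp_all add: sp_closed sp_add)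

lemma sp_zero: "a \<in> effects \<Longrightarrow> a \<odot> 0 = 0"
  using additive_effect_map.L_zero[OF sp_additive] .

text \<open>Since \<open>a\<close> commutes with 0, it commutes with the complement
  \<open>u\<close>, and \<open>u\<close> is a left unit.\<close>

lemma sp_unit: "a \<in> effects \<Longrightarrow> a \<odot> u = a"
  using comm_compl[of a 0] sp_zero_sym[of a 0] sp_zero zero_effect unit_sp by simp

lemma sp_compl: "\<lbrakk>a \<in> effects; b \<in> effects\<rbrakk> \<Longrightarrow> a \<odot> (u - b) = a - a \<odot> b"
  using sp_add[of a b "u - b"] sp_unit compl_effect unit_effect by (simp add: algebra_simps)

text \<open>
  The axioms do not relate scalars to the first argument of the product; all they give is that
  \<open>x / n\<close> commutes with the \<open>n\<close>-fold sum \<open>x\<close>.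
\<close>

lemma comm_self_fraction:
  assumes "x \<in> effects" "n \<ge> 1"
  shows "((1 / real n) *\<^sub>R x) \<odot> x = x \<odot> ((1 / real n) *\<^sub>R x)"
proof -
  define y where "y = (1 / real n) *\<^sub>R x"
  have multiple: "real k *\<^sub>R y \<in> effects" if "k \<le> n" for k
    using scale_effect[of "real k / real n" x] that assms by (simp add: y_def)
  have y: "y \<in> effects" using multiple[of 1] assms by simp
  have "y \<odot> (real k *\<^sub>R y) = (real k *\<^sub>R y) \<odot> y" if "k \<le> n" for k
    using that
  proof (induction k)
    case 0
    then show ?case using sp_zero[OF y] sp_zero_sym[OF y zero_effect] by simp
  next
    case (Suc k)
    have "real (Suc k) *\<^sub>R y = real k *\<^sub>R y + y" by (simp add: algebra_simps)
    then show ?case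
      using comm_add[of "real k *\<^sub>R y" y y] Suc multiple[of k] multiple[of "Suc k"] y by simp
  qed
  from this[of n] show ?thesis using assms by (simp add: y_def)
qed

text \<open>Split \<open>u / n\<close> as \<open>x / n + (u - x) / n\<close>. The first summand
  commutes with \<open>x\<close>; the second commutes with \<open>u - x\<close>, hence with its
  complement \<open>x\<close>.\<close>

lemma comm_unit_fraction:
  assumes x: "x \<in> effects" and n: "n \<ge> 1"
  shows "x \<odot> ((1 / real n) *\<^sub>R u) = ((1 / real n) *\<^sub>R u) \<odot> x"
proof -
  have eff: "(1 / real n) *\<^sub>R y \<in> effects" if "y \<in> effects" for y
    using that n by (intro scale_effect) auto
  have sum: "(1 / real n) *\<^sub>R u = (1 / real n) *\<^sub>R x + (1 / real n) *\<^sub>R (u - x)"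
    by (simp add: algebra_simps)
  have "((1 / real n) *\<^sub>R (u - x)) \<odot> (u - (u - x)) = (u - (u - x)) \<odot> ((1 / real n) *\<^sub>R (u - x))"
    by (rule comm_compl[OF eff[OF compl_effect[OF x]] compl_effect[OF x]
          comm_self_fraction[OF compl_effect[OF x] n]])
  then have "x \<odot> ((1 / real n) *\<^sub>R (u - x)) = ((1 / real n) *\<^sub>R (u - x)) \<odot> x"
    by simp
  then show ?thesis
    using comm_add[OF eff[OF x] eff[OF compl_effect[OF x]] x] eff[OF unit_effect]
      comm_self_fraction[OF x n]
    by (simp flip: sum)
qed

text \<open>Commutation moves the scalar into the second argument, where the product is
  homogeneous.\<close>

lemma unit_fraction_sp:
  assumes "x \<in> effects" "n \<ge> 1"
  shows "((1 / real n) *\<^sub>R u) \<odot> x = (1 / real n) *\<^sub>R x"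
proof -
  have "x \<odot> ((1 / real n) *\<^sub>R u) = (1 / real n) *\<^sub>R (x \<odot> u)"
    by (rule additive_effect_map.L_scale[OF sp_additive[OF assms(1)] unit_effect])
      (use assms(2) in auto)
  then show ?thesis
    unfolding comm_unit_fraction[OF assms] sp_unit[OF assms(1)] .
qed

section \<open>Inverting multiplication by an effect bounded below\<close>

lemma affine_fixed_point:
  assumes b: "b \<in> effects" and w: "w \<in> effects" and bw: "b + w \<in> effects"
    and comm: "b \<odot> w = w \<odot> b"
  obtains t where "t \<in> effects" "t = w + b \<odot> t" "b \<odot> t = t \<odot> b"
proof -
  interpret b: additive_effect_map C u "(\<odot>) b"
    using sp_additive[OF b] .
  \<comment> \<open>The iteration starts at the top: \<open>b + w \<le> u\<close> says that the
    first step goes down, and monotonicity propagates this.\<close>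
  define t where "t = rec_nat u (\<lambda>_ x. w + b \<odot> x)"
  have t_0: "t 0 = u" and t_Suc: "t (Suc i) = w + b \<odot> t i" for i
    by (simp_all add: t_def)
  have F_effect: "w + b \<odot> x \<in> effects" if "x \<in> effects" for x
  proof (rule below_effect[OF _ bw])
    show "w + b \<odot> x \<in> C"
      using add_mem w sp_closed[OF b that] effects_in_cone by blast
    show "b + w - (w + b \<odot> x) \<in> C"
      using b.L_mono[OF that unit_effect effects_le_unit[OF that]] sp_unit[OF b] by simp
  qed
  have t_eff: "t i \<in> effects" for i
    by (induction i) (simp_all add: t_0 t_Suc unit_effect F_effect)
  have t_dec: "t i - t (Suc i) \<in> C" for i
  proof (induction i)
    case 0
    show ?case
      using effects_le_unit[OF t_eff[of "Suc 0"]] by (simp add: t_0)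
  next
    case (Suc i)
    then show ?case
      using b.L_mono[OF t_eff t_eff, of i "Suc i"] by (simp add: t_Suc[of i] t_Suc[of "Suc i"])
  qed
  have t_comm: "b \<odot> t i = t i \<odot> b" for i
  proof (induction i)
    case 0
    show ?case by (simp add: t_0 sp_unit unit_sp b)
  next
    case (Suc i)
    then show ?case
      using comm_add[OF w sp_closed[OF b t_eff[of i]] b] comm comm_sp[OF b t_eff[of i] b]
        F_effect[OF t_eff[of i]]
      by (simp add: t_Suc)
  qed
  obtain x where x: "x \<in> effects" "effect_inf t x"
      "effect_inf (\<lambda>i. b \<odot> t i) (b \<odot> x)" "b \<odot> x = x \<odot> b"
    using descending_inf[of t] t_eff t_dec b t_comm by blast
  \<comment> \<open>As \<open>t\<close> descends, a lower bound of all later terms also bounds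
    \<open>t 0\<close>, so the shift by one is harmless.\<close>
  have lower: "x - y \<in> C" if "y \<in> effects" "\<And>i. t (Suc i) - y \<in> C" for y
  proof -
    have "t i - y \<in> C" for i
      using diff_trans[OF t_dec that(2)] .
    with that x(2) show ?thesis by (simp add: effect_inf_def)
  qed
  have "x - (w + b \<odot> x) \<in> C"
  proof (rule lower[OF F_effect[OF x(1)]])
    fix i show "t (Suc i) - (w + b \<odot> x) \<in> C"
      using x(3) by (simp add: effect_inf_def t_Suc)
  qed
  \<comment> \<open>From \<open>x \<le> t (Suc i) = w + b \<odot> t i\<close>, the element
    \<open>x - w\<close> lies below every \<open>b \<odot> t i\<close>, hence below their infimum
    \<open>b \<odot> x\<close>. Being an effect, it is an admissible lower bound.\<close>
  moreover have "(w + b \<odot> x) - x \<in> C"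
  proof -
    have "x - w \<in> C"
      using sp_closed[OF b t_eff] effects_in_cone by (intro lower w) (simp add: t_Suc)
    then have "x - w \<in> effects"
      using below_effect[OF _ x(1)] effects_in_cone[OF w] by simp
    moreover have "b \<odot> t i - (x - w) \<in> C" for i
    proof -
      have "t (Suc i) - x \<in> C"
        using x(2) by (simp add: effect_inf_def)
      then show ?thesis by (simp add: t_Suc algebra_simps)
    qed
    ultimately have "b \<odot> x - (x - w) \<in> C"
      using x(3) by (simp add: effect_inf_def)
    then show ?thesis by (simp add: algebra_simps)
  qed
  ultimately have "x = w + b \<odot> x" by (rule cone_antisym)
  with x show ?thesis by (intro that)
qed

text \<open>
  Only infima of descending sequences are available, so the fixed point equation is solved for the
  complement \<open>t = u - s\<close>, where it reads \<open>t = (a - u / n) + (u - a) \<odot> t\<close>.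
\<close>

lemma scaled_inverse:
  assumes a: "a \<in> effects" and n: "n \<ge> 1" and above: "a - (1 / real n) *\<^sub>R u \<in> C"
  obtains s where "s \<in> effects" "a \<odot> s = (1 / real n) *\<^sub>R u" "s \<odot> a = (1 / real n) *\<^sub>R u"
proof -
  define e where "e = (1 / real n) *\<^sub>R u"
  define b where "b = u - a"
  have e: "e \<in> effects"
    using n unfolding e_def by (intro scale_effect unit_effect) auto
  have b: "b \<in> effects"
    using a by (simp add: b_def compl_effect)
  have w: "a - e \<in> effects"
    using below_effect[OF _ a] above effects_in_cone[OF e] by (simp add: e_def)
  have bw: "b + (a - e) \<in> effects"
    using compl_effect[OF e] by (simp add: b_def)
  \<comment> \<open>That \<open>b\<close> commutes with \<open>a - e\<close> follows via the
    complement \<open>e + b\<close>, both of whose summands commute with \<open>b\<close>.\<close>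
  have eb: "e + b = u - (a - e)" by (simp add: b_def)
  have "b \<odot> (e + b) = (e + b) \<odot> b"
    using comm_add[OF e b b] comm_unit_fraction[OF b n] compl_effect[OF w]
    by (simp add: eb flip: e_def)
  then have "b \<odot> (a - e) = (a - e) \<odot> b"
    using comm_compl[OF b compl_effect[OF w]] by (simp add: eb)
  then obtain t where t: "t \<in> effects" "t = (a - e) + b \<odot> t" "b \<odot> t = t \<odot> b"
    using affine_fixed_point[OF b w bw] by metis
  define s where "s = u - t"
  have s: "s \<in> effects"
    using t by (simp add: s_def compl_effect)
  have bs: "b \<odot> s = s \<odot> b"
    using comm_compl[OF b t(1,3)] by (simp add: s_def)
  \<comment> \<open>Complementing the fixed point equation gives \<open>b \<odot> s = s - e\<close>;
    as \<open>a\<close> is the complement of \<open>b\<close>, this yields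
    \<open>s \<odot> a = s - s \<odot> b = e\<close>.\<close>
  have "b \<odot> s = b - b \<odot> t"
    using sp_compl[OF b t(1)] by (simp add: s_def)
  also have "\<dots> = s - e"
    using t(2) by (simp add: b_def s_def algebra_simps)
  finally have "s \<odot> a = e"
    using sp_compl[OF s b] bs by (simp add: b_def[symmetric]) (simp add: b_def)
  moreover have "s \<odot> a = a \<odot> s"
    using comm_compl[OF s b] bs by (simp add: b_def)
  ultimately show ?thesis using s by (intro that) (simp_all add: e_def)
qed

lemma effect_order_isomorphism:
  assumes a: "a \<in> effects" and n: "n \<ge> 1" and above: "a - (1 / real n) *\<^sub>R u \<in> C"
  shows "\<exists>\<Phi>. order_isomorphism \<Phi> \<and> \<Phi> u = a"
proof -
  obtain s where s: "s \<in> effects" "a \<odot> s = (1 / real n) *\<^sub>R u" "s \<odot> a = (1 / real n) *\<^sub>R u"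
    using scaled_inverse[OF assms] by metis
  interpret A: additive_effect_map C u "(\<odot>) a"
    using sp_additive[OF a] .
  interpret S: additive_effect_map C u "(\<odot>) s"
    using sp_additive[OF s(1)] .
  have lin: "linear A.extension" "linear S.extension"
    using A.extension_linear S.extension_linear .
  have *: "A.extension (S.extension x) = (1 / real n) *\<^sub>R x \<and>
        S.extension (A.extension x) = (1 / real n) *\<^sub>R x" if "x \<in> effects" for x
    using that comm_assoc[OF a s(1) that] comm_assoc[OF s(1) a that] s(2,3)
      unit_fraction_sp[OF that n]
    by (simp add: A.extension_effect S.extension_effect A.L_closed S.L_closed)
  have inverse: "A.extension (S.extension v) = (1 / real n) *\<^sub>R v \<and>
        S.extension (A.extension v) = (1 / real n) *\<^sub>R v" for v
  proof -
    obtain r x y where "r > 0" "x \<in> effects" "y \<in> effects" "v = r *\<^sub>R (x - y)"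
      using vector_scaled_diff by metis
    then show ?thesis
      using *
      by (simp add: linear_cmul[OF lin(1)] linear_cmul[OF lin(2)]
          linear_diff[OF lin(1)] linear_diff[OF lin(2)] scaleR_diff_right scaleR_left_commute)
  qed
  \<comment> \<open>The two extensions are mutually inverse up to the factor \<open>1 / n\<close>,
    so the inverse is \<open>n\<close> times \<open>S.extension\<close>; its positivity makes
    \<open>A.extension\<close> reflect the cone.\<close>
  have "bij A.extension"
    by (rule o_bij[where g = "\<lambda>v. real n *\<^sub>R S.extension v"])
      (use n inverse in \<open>auto simp: fun_eq_iff linear_cmul[OF lin(1)]\<close>)
  moreover have "v \<in> C" if "A.extension v \<in> C" for v
    using scale_mem[OF _ S.extension_positive[OF that], of "real n"] n inverse[of v] by simp
  ultimately have "order_isomorphism A.extension"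
    unfolding order_isomorphism_def using lin A.extension_positive by blast
  moreover have "A.extension u = a"
    by (simp add: A.extension_effect unit_effect sp_unit a)
  ultimately show ?thesis by blast
qed

theorem homogeneous: homogeneous_cone
proof (rule homogeneous_coneI)
  fix a assume int: "a \<in> mtopology interior_of C"
  obtain e where e: "e > 0" "a - e *\<^sub>R u \<in> C"
    using interior_above_unit[OF int] by metis
  then have "a \<in> C"
    using add_mem[OF _ scale_mem[OF _ unit_mem], of "a - e *\<^sub>R u" e] by simp
  then obtain r x where r: "r > 0" "x \<in> effects" "a = r *\<^sub>R x"
    using cone_scaled_effect by metis
  \<comment> \<open>With \<open>1 / n < e / r\<close>, the bound \<open>a \<ge> e u\<close> becomes
    \<open>x \<ge> (e / r) u \<ge> u / n\<close> for the rescaled point \<open>x\<close>.\<close>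
  obtain n :: nat where n: "n \<ge> 1" "1 / real n < e / r"
    using reals_Archimedean[of "e / r"] e(1) r(1)
    by (metis One_nat_def Suc_leI zero_less_Suc divide_pos_pos inverse_eq_divide)
  have "(1 / r) *\<^sub>R (a - e *\<^sub>R u) + (e / r - 1 / real n) *\<^sub>R u \<in> C"
    using e r n by (intro add_mem scale_mem unit_mem) auto
  then have "x - (1 / real n) *\<^sub>R u \<in> C"
    using r by (simp add: algebra_simps)
  then obtain \<Phi> where "order_isomorphism \<Phi>" "\<Phi> u = x"
    using effect_order_isomorphism[OF r(2) n(1)] by blast
  then show "\<exists>\<Phi>. order_isomorphism \<Phi> \<and> \<Phi> u = a"
    using r order_isomorphism_comp[OF order_isomorphism_scale[OF r(1)]]
    by (intro exI[of _ "(*\<^sub>R) r \<circ> \<Phi>"]) simp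
qed

end

section \<open>Transport of the sequential product to the unit interval\<close>

lemma (in sigma_sequential_effect_algebra) effect_product_transport:
  fixes C :: "'v::real_vector set" and u :: 'v
  assumes ous: "order_unit_space C u"
    and iso: "convex_ea_iso f E smul (order_unit_space.unit_interval C u) (*\<^sub>R)"
  defines "g \<equiv> inv_into (ea_carrier E) f"
  shows "effect_product C u (\<lambda>x y. f (sprod (g x) (g y)))"
proof -
  interpret order_unit_space C u by fact
  have bij: "bij_betw f (ea_carrier E) effects"
    and f_zero: "f (ea_zero E) = 0" and f_one: "f (ea_one E) = u"
    and f_summable: "\<And>x y. \<lbrakk>x \<in> ea_carrier E; y \<in> ea_carrier E\<rbrakk>
        \<Longrightarrow> ea_summable E x y \<longleftrightarrow> u - (f x + f y) \<in> C"
    and f_add: "\<And>x y. \<lbrakk>x \<in> ea_carrier E; y \<in> ea_carrier E; ea_summable E x y\<rbrakk>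
        \<Longrightarrow> f (ea_add E x y) = f x + f y"
    using iso by (auto simp: convex_ea_iso_def unit_interval_def effects_def cone_le_def)
  have f_eff: "f x \<in> effects" if "x \<in> ea_carrier E" for x
    using bij that by (auto simp: bij_betw_def)
  have g_car: "g x \<in> ea_carrier E" and fg: "f (g x) = x" if "x \<in> effects" for x
    using bij that unfolding g_def by (auto simp: bij_betw_def inv_into_into f_inv_into_f)
  have gf: "g (f x) = x" if "x \<in> ea_carrier E" for x
    using bij that unfolding g_def by (auto simp: bij_betw_def)
  have f_inj: "x = y" if "x \<in> ea_carrier E" "y \<in> ea_carrier E" "f x = f y" for x y
    using that gf by metis
  have g_summable: "ea_summable E (g x) (g y)"
    if "x \<in> effects" "y \<in> effects" "x + y \<in> effects" for x y
    using that by (simp add: f_summable g_car fg effects_le_unit)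
  have g_add: "g (x + y) = ea_add E (g x) (g y)"
    if "x \<in> effects" "y \<in> effects" "x + y \<in> effects" for x y
    using that g_summable[OF that]
    by (intro f_inj) (simp_all add: f_add g_car fg add_closed)
  have g_compl: "g (u - x) = ea_compl E (g x)" if "x \<in> effects" for x
    unfolding ea_compl_def
  proof (rule sym, rule the1_equality[OF compl_unique[OF g_car[OF that]]])
    show "g (u - x) \<in> ea_carrier E \<and> ea_summable E (g x) (g (u - x))
        \<and> ea_add E (g x) (g (u - x)) = ea_one E"
      using g_add[of x "u - x"] g_summable[of x "u - x"] that unit_effect compl_effect
        gf[OF one_closed] by (simp add: g_car f_one)
  qed
  have g_zero: "g 0 = ea_zero E" and g_one: "g u = ea_one E"
    using gf zero_closed one_closed f_zero f_one by metis+
  have le_iff: "ea_le E x y \<longleftrightarrow> f y - f x \<in> C" if "x \<in> ea_carrier E" "y \<in> ea_carrier E" for x y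
  proof
    assume "ea_le E x y"
    then show "f y - f x \<in> C"
      using that f_add f_eff effects_in_cone by (auto simp: ea_le_def)
  next
    assume "f y - f x \<in> C"
    \<comment> \<open>The difference of comparable effects is an effect, so its preimage under
      \<open>f\<close> can serve as the missing summand.\<close>
    then have d: "f y - f x \<in> effects"
      using below_effect[OF _ f_eff[OF that(2)]] effects_in_cone[OF f_eff[OF that(1)]] by simp
    show "ea_le E x y"
      unfolding ea_le_def
      using g_summable[of "f x" "f y - f x"] g_add[of "f x" "f y - f x"] that
      by (intro bexI[of _ "g (f y - f x)"]) (simp_all add: gf f_eff d g_car)
  qed
  have inf_transport: "ea_is_inf E (range a) x \<longleftrightarrow> effect_inf (\<lambda>i. f (a i)) (f x)"
    if "\<And>i. a i \<in> ea_carrier E" "x \<in> ea_carrier E" for a x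
  proof -
    \<comment> \<open>Surjectivity of \<open>f\<close> makes the competing lower bounds on the two
      sides correspond.\<close>
    have "(\<forall>y\<in>ea_carrier E. P (f y)) \<longleftrightarrow> (\<forall>y\<in>effects. P y)" for P
      using f_eff g_car fg by metis
    from this[of "\<lambda>y. (\<forall>i. f (a i) - y \<in> C) \<longrightarrow> f x - y \<in> C"] show ?thesis
      using that by (simp add: ea_is_inf_def effect_inf_def le_iff)
  qed
  have comm_iff: "ea_commutes sprod (g x) (g y) \<longleftrightarrow> f (sprod (g x) (g y)) = f (sprod (g y) (g x))"
    if "x \<in> effects" "y \<in> effects" for x y
    unfolding ea_commutes_def
    using that f_inj[OF sprod_closed sprod_closed] g_car by metis
  have g_sp: "g (f (sprod (g x) (g y))) = sprod (g x) (g y)"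
    if "x \<in> effects" "y \<in> effects" for x y
    using that by (simp add: gf sprod_closed g_car)
  show ?thesis
  proof
    fix a b assume "a \<in> effects" "b \<in> effects"
    then show "f (sprod (g a) (g b)) \<in> effects"
      by (simp add: f_eff sprod_closed g_car)
  next
    fix a b c assume "a \<in> effects" "b \<in> effects" "c \<in> effects" "b + c \<in> effects"
    then show "f (sprod (g a) (g (b + c))) = f (sprod (g a) (g b)) + f (sprod (g a) (g c))"
      using sprod_add[OF g_car g_car g_car g_summable]
      by (simp add: g_add f_add sprod_closed g_car)
  next
    fix a assume "a \<in> effects"
    then show "f (sprod (g u) (g a)) = a"
      by (simp add: g_one one_sprod g_car fg)
  next
    fix a b assume "a \<in> effects" "b \<in> effects" "f (sprod (g a) (g b)) = 0"
    then show "f (sprod (g b) (g a)) = 0"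
      using sprod_zero_sym[of "g a" "g b"] g_sp g_zero f_zero g_car by metis
  next
    fix a b assume "a \<in> effects" "b \<in> effects" "f (sprod (g a) (g b)) = f (sprod (g b) (g a))"
    then show "f (sprod (g a) (g (u - b))) = f (sprod (g (u - b)) (g a))"
      using commutes_compl[of "g a" "g b"] comm_iff[of a b]
      by (simp add: g_car g_compl) (simp add: ea_commutes_def)
  next
    fix a b c assume *: "a \<in> effects" "b \<in> effects" "c \<in> effects"
      "f (sprod (g a) (g b)) = f (sprod (g b) (g a))"
    then have "ea_commutes sprod (g a) (g b)"
      by (simp add: comm_iff)
    from commutes_assoc[OF g_car g_car g_car this, of c] *(1-3)
    show "f (sprod (g a) (g (f (sprod (g b) (g c)))))
        = f (sprod (g (f (sprod (g a) (g b)))) (g c))"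
      by (simp add: g_sp)
  next
    fix a b c assume *: "a \<in> effects" "b \<in> effects" "c \<in> effects"
      "f (sprod (g c) (g a)) = f (sprod (g a) (g c))" "f (sprod (g c) (g b)) = f (sprod (g b) (g c))"
    then have "ea_commutes sprod (g c) (sprod (g a) (g b))"
      by (intro commutes_sprod) (simp_all add: comm_iff g_car)
    with *(1-3) show "f (sprod (g c) (g (f (sprod (g a) (g b)))))
        = f (sprod (g (f (sprod (g a) (g b)))) (g c))"
      by (simp only: g_sp ea_commutes_def)
  next
    fix a b c assume *: "a \<in> effects" "b \<in> effects" "c \<in> effects" "a + b \<in> effects"
      "f (sprod (g c) (g a)) = f (sprod (g a) (g c))" "f (sprod (g c) (g b)) = f (sprod (g b) (g c))"
    then have "ea_commutes sprod (g c) (ea_add E (g a) (g b))"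
      by (intro commutes_add) (simp_all add: comm_iff g_car g_summable)
    with *(1-4) show "f (sprod (g c) (g (a + b))) = f (sprod (g (a + b)) (g c))"
      by (simp only: g_add ea_commutes_def)
  next
    fix t :: "nat \<Rightarrow> 'v"
    assume t: "\<And>i. t i \<in> effects" "\<And>i. t i - t (Suc i) \<in> C"
    \<comment> \<open>The sequence is pulled back to \<open>E\<close>, its infimum \<open>x\<close>
      is taken there, and \<open>f x\<close> is the witness in \<open>V\<close>.\<close>
    have desc: "ea_descending E (\<lambda>i. g (t i))"
      using t by (simp add: ea_descending_def le_iff g_car fg)
    then obtain x where inf: "ea_is_inf E (range (\<lambda>i. g (t i))) x"
      using inf_exists by blast
    then have x: "x \<in> ea_carrier E" by (simp add: ea_is_inf_def)
    have "effect_inf t (f x)"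
      using inf inf_transport[of "\<lambda>i. g (t i)" x] x t by (simp add: g_car fg)
    moreover have "effect_inf (\<lambda>i. f (sprod (g b) (g (t i)))) (f (sprod (g b) x))"
      if "b \<in> effects" for b
      using sprod_inf[OF desc inf g_car[OF that]] that x t
      by (subst inf_transport[symmetric]) (simp_all add: sprod_closed g_car)
    moreover have "f (sprod (g b) x) = f (sprod x (g b))"
      if "b \<in> effects" "\<forall>i. f (sprod (g b) (g (t i))) = f (sprod (g (t i)) (g b))" for b
      using commutes_inf[OF desc inf g_car[OF that(1)]] that t
      by (simp add: comm_iff) (simp add: ea_commutes_def)
    ultimately show "\<exists>x\<in>effects. effect_inf t x \<and>
        (\<forall>b\<in>effects. effect_inf (\<lambda>i. f (sprod (g b) (g (t i)))) (f (sprod (g b) (g x))) \<and>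
          ((\<forall>i. f (sprod (g b) (g (t i))) = f (sprod (g (t i)) (g b))) \<longrightarrow>
            f (sprod (g b) (g x)) = f (sprod (g x) (g b))))"
      using x by (intro bexI[of _ "f x"]) (simp_all add: gf f_eff)
  qed
qed

theorem theorem4p16:
  fixes E :: "'e ea"
    and sprod :: "'e \<Rightarrow> 'e \<Rightarrow> 'e"
    and smul :: "real \<Rightarrow> 'e \<Rightarrow> 'e"
    and C :: "'v::real_vector set"
    and u :: 'v
  assumes "sequential_effect_space E sprod smul"
    and "associated_order_unit_space E smul C u"
  shows "order_unit_space.homogeneous_cone C u"
proof -
  obtain f where "order_unit_space C u"
    and "convex_ea_iso f E smul (order_unit_space.unit_interval C u) (*\<^sub>R)"
    using assms(2) by (auto simp: associated_order_unit_space_def)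
  moreover have "sigma_sequential_effect_algebra E sprod"
    using assms(1) by (simp add: sequential_effect_space_def)
  ultimately show ?thesis
    using sigma_sequential_effect_algebra.effect_product_transport effect_product.homogeneous
    by metis
qed

end
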